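(* Let $\Gamma_A=(A,\alpha)$ and $\Gamma_B=(B,\beta)$ be two non-negative games, and let $i\in A$. The partial tensor product restricts to a well-defined map on imputations $$(-\otimes_i-):I(\Gamma_A)\times I(\Gamma_B)\longrightarrow I(\Gamma_A\circ_i\Gamma_B).$$ Furthermore, if $\alpha(\{i\})$ and $\beta(B)$ are positive, this map is injective.
   Context: A game is a pair $\Gamma=(N,v)$, $N$ a nonempty finite totally ordered set of players, $v:\mathcal P(N)\to\mathbb R$ with $v(\emptyset)=0$; it is non-negative if $v(S)\ge0$ for all $S\subseteq N$. Its set of imputations is $I(\Gamma)=\{x\in\mathbb R^N:\sum_{j\in N}x_j=v(N),\ x_j\ge v(\{j\})\ \forall j\in N\}$. For games $(A,\alpha)$, $(B,\beta)$ with disjoint player sets and $i\in A$, the game $(A,\alpha)\circ_i(B,\beta)$ has player set $A\diamond_iB=(A\setminus\{i\})\cup B$ and coalition function $$(\alpha\circ_i\beta)(S)=\beta(B)\alpha(S\cap A)+\partial_i\alpha(S\cap A)\,\beta(S\cap B),\qquad \partial_i\alpha(T)=\alpha(T\cup\{i\})-\alpha(T\setminus\{i\}).$$ The partial tensor product of $x\in\mathbb R^A$ and $y\in\mathbb R^B$ is the vector $x\otimes_iy\in\mathbb R^{A\diamond_iB}$ with $(x\otimes_iy)_j=\big(\sum_{l\in B}y_l\big)x_j$ for $j\in A\setminus\{i\}$ and $(x\otimes_iy)_j=x_iy_j$ for $j\in B$. *)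

theory Defs
  imports "HOL-Analysis.Analysis"
begin

text \<open>Players are elements of an ambient type. A coalition function is a total function on sets,
  of which only the values on subsets of the player set are ever used. The total order on the
  players is the relation \<open>r\<close>; neither imputations nor the tensor product depend on it.\<close>

definition is_game :: "'a set \<Rightarrow> 'a rel \<Rightarrow> ('a set \<Rightarrow> real) \<Rightarrow> bool" where
  "is_game N r v \<longleftrightarrow> finite N \<and> N \<noteq> {} \<and> linear_order_on N r \<and> v {} = 0"

definition nonneg_game :: "'a set \<Rightarrow> 'a rel \<Rightarrow> ('a set \<Rightarrow> real) \<Rightarrow> bool" where
  "nonneg_game N r v \<longleftrightarrow> is_game N r v \<and> (\<forall>S\<subseteq>N. v S \<ge> 0)"

text \<open>Vectors indexed by \<open>N\<close> are the extensional functions on \<open>N\<close>, so that equality of vectors is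
  equality of their coordinates in \<open>N\<close>.\<close>

definition imputations :: "'a set \<Rightarrow> ('a set \<Rightarrow> real) \<Rightarrow> ('a \<Rightarrow> real) set" where
  "imputations N v =
     {x \<in> N \<rightarrow>\<^sub>E (UNIV :: real set). (\<Sum>j\<in>N. x j) = v N \<and> (\<forall>j\<in>N. x j \<ge> v {j})}"

definition comp_players :: "'a set \<Rightarrow> 'a \<Rightarrow> 'a set \<Rightarrow> 'a set" where
  "comp_players A i B = (A - {i}) \<union> B"

definition marginal :: "'a \<Rightarrow> ('a set \<Rightarrow> real) \<Rightarrow> 'a set \<Rightarrow> real" where
  "marginal i v T = v (T \<union> {i}) - v (T - {i})"

definition comp_value ::
  "'a set \<Rightarrow> ('a set \<Rightarrow> real) \<Rightarrow> 'a \<Rightarrow> 'a set \<Rightarrow> ('a set \<Rightarrow> real) \<Rightarrow> 'a set \<Rightarrow> real" where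
  "comp_value A \<alpha> i B \<beta> S = \<beta> B * \<alpha> (S \<inter> A) + marginal i \<alpha> (S \<inter> A) * \<beta> (S \<inter> B)"

definition partial_tensor ::
  "'a set \<Rightarrow> 'a \<Rightarrow> 'a set \<Rightarrow> ('a \<Rightarrow> real) \<Rightarrow> ('a \<Rightarrow> real) \<Rightarrow> ('a \<Rightarrow> real)" where
  "partial_tensor A i B x y =
     (\<lambda>j\<in>comp_players A i B. if j \<in> B then x i * y j else (\<Sum>l\<in>B. y l) * x j)"

end

theory Submission
  imports Defs
begin

text \<open>On imputations the factor \<open>\<Sum>l\<in>B. y l\<close> of the partial tensor product is the constant \<open>\<beta> B\<close>.
  The block \<open>B\<close> of \<open>x \<otimes>\<^sub>i y\<close> therefore carries the total \<open>x i * \<beta> B\<close>, just what player \<open>i\<close> would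
  have received after scaling \<open>x\<close> by \<open>\<beta> B\<close>, and the grand total is \<open>\<beta> B * \<alpha> A\<close>. The composed
  game has the same grand value, since there the marginal contribution of \<open>i\<close> to \<open>A - {i}\<close>
  restores \<open>\<alpha> A\<close>. Its singletons have value \<open>\<beta> B * \<alpha> {j}\<close> or \<open>\<alpha> {i} * \<beta> {j}\<close>, so individual
  rationality is a product of inequalities between nonnegative numbers.

  For injectivity, division by \<open>\<beta> B\<close> recovers \<open>x\<close> away from \<open>i\<close>; efficiency of \<open>x\<close>, whose
  total is prescribed, then determines \<open>x i\<close>; and \<open>x i \<ge> \<alpha> {i} > 0\<close> allows division by \<open>x i\<close>,
  which recovers \<open>y\<close>.\<close>

lemma sum_partial_tensor:
  assumes "finite A" "finite B" "A \<inter> B = {}" "i \<in> A"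
  shows "(\<Sum>j\<in>comp_players A i B. partial_tensor A i B x y j) = (\<Sum>l\<in>B. y l) * (\<Sum>j\<in>A. x j)"
proof -
  let ?z = "partial_tensor A i B x y"
  have disj: "(A - {i}) \<inter> B = {}" using assms by blast
  have "(\<Sum>j\<in>comp_players A i B. ?z j) = (\<Sum>j\<in>A - {i}. ?z j) + (\<Sum>j\<in>B. ?z j)"
    unfolding comp_players_def using assms disj by (intro sum.union_disjoint) auto
  also have "(\<Sum>j\<in>A - {i}. ?z j) = (\<Sum>l\<in>B. y l) * (\<Sum>j\<in>A - {i}. x j)"
    unfolding sum_distrib_left using disj
    by (intro sum.cong) (auto simp: partial_tensor_def comp_players_def)
  also have "(\<Sum>j\<in>B. ?z j) = (\<Sum>l\<in>B. y l) * x i"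
    by (simp add: partial_tensor_def comp_players_def sum_distrib_left mult.commute)
  also have "(\<Sum>l\<in>B. y l) * (\<Sum>j\<in>A - {i}. x j) + (\<Sum>l\<in>B. y l) * x i = (\<Sum>l\<in>B. y l) * (\<Sum>j\<in>A. x j)"
    using sum.remove[OF assms(1,4), of x] by (simp add: algebra_simps)
  finally show ?thesis .
qed

lemma comp_value_grand_coalition:
  assumes "A \<inter> B = {}" "i \<in> A"
  shows "comp_value A \<alpha> i B \<beta> (comp_players A i B) = \<beta> B * \<alpha> A"
proof -
  have "comp_players A i B \<inter> A = A - {i}" "comp_players A i B \<inter> B = B" "insert i A = A"
    using assms by (auto simp: comp_players_def)
  then show ?thesis
    by (simp add: comp_value_def marginal_def algebra_simps)
qed

lemma comp_value_singleton_outer: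
  assumes "A \<inter> B = {}" "\<beta> {} = 0" "j \<in> A"
  shows "comp_value A \<alpha> i B \<beta> {j} = \<beta> B * \<alpha> {j}"
proof -
  have "{j} \<inter> A = {j}" "{j} \<inter> B = {}" using assms by auto
  then show ?thesis using assms by (simp add: comp_value_def)
qed

lemma comp_value_singleton_inner:
  assumes "A \<inter> B = {}" "\<alpha> {} = 0" "j \<in> B"
  shows "comp_value A \<alpha> i B \<beta> {j} = \<alpha> {i} * \<beta> {j}"
proof -
  have "{j} \<inter> A = {}" "{j} \<inter> B = {j}" using assms by auto
  then show ?thesis using assms by (simp add: comp_value_def marginal_def)
qed

text \<open>Non-negativity is what makes the products monotone. A player in \<open>A - {i}\<close> requires
  \<open>\<beta> B \<ge> 0\<close>, because the inequality \<open>\<alpha> {j} \<le> x j\<close> is scaled by \<open>\<beta> B\<close>. A player in \<open>B\<close> requires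
  \<open>\<beta> {j} \<ge> 0\<close> and \<open>x i \<ge> \<alpha> {i} \<ge> 0\<close>, because \<open>\<alpha> {i} \<le> x i\<close> and \<open>\<beta> {j} \<le> y j\<close> are multiplied.\<close>

lemma partial_tensor_in_imputations:
  assumes A: "nonneg_game A rA \<alpha>" and B: "nonneg_game B rB \<beta>"
    and disj: "A \<inter> B = {}" and i: "i \<in> A"
    and x: "x \<in> imputations A \<alpha>" and y: "y \<in> imputations B \<beta>"
  shows "partial_tensor A i B x y \<in> imputations (comp_players A i B) (comp_value A \<alpha> i B \<beta>)"
proof -
  have fin: "finite A" "finite B" and zero: "\<alpha> {} = 0" "\<beta> {} = 0"
    and pos: "\<And>S. S \<subseteq> A \<Longrightarrow> \<alpha> S \<ge> 0" "\<And>S. S \<subseteq> B \<Longrightarrow> \<beta> S \<ge> 0"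
    using A B by (auto simp: nonneg_game_def is_game_def)
  have sums: "(\<Sum>j\<in>A. x j) = \<alpha> A" "(\<Sum>j\<in>B. y j) = \<beta> B"
    and rat: "\<And>j. j \<in> A \<Longrightarrow> \<alpha> {j} \<le> x j" "\<And>j. j \<in> B \<Longrightarrow> \<beta> {j} \<le> y j"
    using x y by (auto simp: imputations_def)
  have "comp_value A \<alpha> i B \<beta> {j} \<le> partial_tensor A i B x y j" if j: "j \<in> comp_players A i B" for j
  proof (cases "j \<in> B")
    case True
    have "0 \<le> \<alpha> {i}" "0 \<le> \<beta> {j}" using pos i True by auto
    then have "\<alpha> {i} * \<beta> {j} \<le> x i * y j"
      using rat(1)[OF i] rat(2)[OF True] by (intro mult_mono) auto
    with True j show ?thesis
      by (simp add: comp_value_singleton_inner[of A B \<alpha> j i \<beta>, OF disj zero(1) True] partial_tensor_def)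
  next
    case False
    then have "j \<in> A" using j by (auto simp: comp_players_def)
    then have "\<beta> B * \<alpha> {j} \<le> \<beta> B * x j" using rat(1) pos(2) by (intro mult_left_mono) auto
    with False j show ?thesis
      by (simp add: comp_value_singleton_outer[of A B \<beta> j \<alpha> i, OF disj zero(2) \<open>j \<in> A\<close>]
          partial_tensor_def sums)
  qed
  moreover have "partial_tensor A i B x y \<in> comp_players A i B \<rightarrow>\<^sub>E UNIV"
    by (simp add: partial_tensor_def)
  ultimately show ?thesis
    using sum_partial_tensor[OF fin disj i, of x y]
      comp_value_grand_coalition[OF disj i, of \<alpha> \<beta>]
    by (simp add: imputations_def sums)
qed

lemma partial_tensor_inj_on_imputations:
  assumes fin: "finite A" and disj: "A \<inter> B = {}" and i: "i \<in> A"
    and pos: "\<alpha> {i} > 0" "\<beta> B > 0"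
  shows "inj_on (\<lambda>(x, y). partial_tensor A i B x y) (imputations A \<alpha> \<times> imputations B \<beta>)"
proof -
  have "x = x' \<and> y = y'"
    if x: "x \<in> imputations A \<alpha>" "x' \<in> imputations A \<alpha>"
      and y: "y \<in> imputations B \<beta>" "y' \<in> imputations B \<beta>"
      and eq: "partial_tensor A i B x y = partial_tensor A i B x' y'" for x x' y y'
  proof -
    have ext: "x \<in> extensional A" "x' \<in> extensional A" "y \<in> extensional B" "y' \<in> extensional B"
      and sums: "(\<Sum>j\<in>A. x j) = \<alpha> A" "(\<Sum>j\<in>A. x' j) = \<alpha> A"
        "(\<Sum>j\<in>B. y j) = \<beta> B" "(\<Sum>j\<in>B. y' j) = \<beta> B"
      and "x i \<ge> \<alpha> {i}"
      using x y i by (auto simp: imputations_def PiE_def)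
    have off: "x j = x' j" if "j \<in> A - {i}" for j
    proof -
      have "j \<notin> B" using that disj by blast
      then show ?thesis
        using fun_cong[OF eq, of j] that pos(2)
        by (simp add: partial_tensor_def comp_players_def sums)
    qed
    then have "(\<Sum>j\<in>A - {i}. x j) = (\<Sum>j\<in>A - {i}. x' j)" by (rule sum.cong[OF refl])
    then have at: "x i = x' i"
      using sum.remove[OF fin i, of x] sum.remove[OF fin i, of x'] sums by simp
    have "y j = y' j" if "j \<in> B" for j
      using fun_cong[OF eq, of j] that pos(1) \<open>x i \<ge> \<alpha> {i}\<close>
      by (auto simp: partial_tensor_def comp_players_def at[symmetric])
    then have "y = y'" by (rule extensionalityI[OF ext(3,4)])
    moreover have "x = x'"
    proof (rule extensionalityI[OF ext(1,2)])
      show "x j = x' j" if "j \<in> A" for j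
        using off at that by (cases "j = i") auto
    qed
    ultimately show ?thesis by simp
  qed
  then show ?thesis by (auto simp: inj_on_def)
qed

theorem proposition15:
  fixes A B :: "'a set" and rA rB :: "'a rel" and \<alpha> \<beta> :: "'a set \<Rightarrow> real" and i :: 'a
  assumes "nonneg_game A rA \<alpha>"
    and "nonneg_game B rB \<beta>"
    and "A \<inter> B = {}"
    and "i \<in> A"
  shows "(\<lambda>(x, y). partial_tensor A i B x y) \<in>
           imputations A \<alpha> \<times> imputations B \<beta> \<rightarrow>
             imputations (comp_players A i B) (comp_value A \<alpha> i B \<beta>) \<and>
         (\<alpha> {i} > 0 \<and> \<beta> B > 0 \<longrightarrow>
           inj_on (\<lambda>(x, y). partial_tensor A i B x y) (imputations A \<alpha> \<times> imputations B \<beta>))"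
proof (intro conjI impI)
  show "(\<lambda>(x, y). partial_tensor A i B x y) \<in> imputations A \<alpha> \<times> imputations B \<beta> \<rightarrow>
      imputations (comp_players A i B) (comp_value A \<alpha> i B \<beta>)"
    using partial_tensor_in_imputations[OF assms] by auto
next
  assume "\<alpha> {i} > 0 \<and> \<beta> B > 0"
  moreover have "finite A" using assms(1) by (simp add: nonneg_game_def is_game_def)
  ultimately show "inj_on (\<lambda>(x, y). partial_tensor A i B x y) (imputations A \<alpha> \<times> imputations B \<beta>)"
    using partial_tensor_inj_on_imputations[of A B i \<alpha> \<beta>] assms(3,4) by simp
qed

end
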